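(* Let $A\in\mathbb{R}^{n\times n}$, $n=2\ell$, be nonsingular and skew-symmetric with simple eigenvalues $\pm\mathrm{i}\sigma_j$, $\sigma_1>\sigma_2>\dots>\sigma_\ell>0$. Let $m<\ell$, suppose the $m$-step SSLBD process with unit-length starting vector $q_1$ does not break down, and let $p_1=Aq_1/\|Aq_1\|$, $$\mathcal{U}_m=\mathcal{K}(A^2,m,p_1),\qquad \mathcal{V}_m=\mathcal{K}(A^2,m,q_1).$$ Let $Y=[p_1,q_1]$, $\mathcal{Y}=\mathcal{R}(Y)$, $X_j=[u_j,v_j]$, $\mathcal{X}_j=\mathcal{R}(X_j)$. Then for any integer $1\le j<m$ such that $X_j^HY$ is nonsingular, $$\|\tan\angle(\mathcal{U}_m\oplus\mathcal{V}_m,\mathcal{X}_j)\|_F\le\frac{\eta_j}{\chi_{m-j}(\xi_j)}\,\|\tan\angle(\mathcal{Y},\mathcal{X}_j)\|_F,$$ where $\chi_i(\cdot)$ is the degree $i$ Chebyshev polynomial of the first kind and $$\xi_j=1+2\cdot\frac{\sigma_j^2-\sigma_{j+1}^2}{\sigma_{j+1}^2-\sigma_\ell^2},\qquad \eta_j=\begin{cases}1,& j=1,\\[4pt] \displaystyle\prod_{i=1}^{j-1}\frac{\sigma_i^2-\sigma_\ell^2}{\sigma_i^2-\sigma_j^2},& j>1.\end{cases}$$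
   Context: Singular vectors: $u_1,\dots,u_\ell,v_1,\dots,v_\ell\in\mathbb{R}^n$ form an orthonormal basis of $\mathbb{R}^n$ with $Av_j=\sigma_ju_j$ and $Au_j=-\sigma_jv_j$; thus $(\sigma_j,u_j,v_j)$ is a singular triplet of $A$, and $\mathcal{X}_j=\mathrm{span}\{u_j,v_j\}$ is the two-dimensional eigenspace of $A$ associated with $\pm\mathrm{i}\sigma_j$. SSLBD process: set $\gamma_0=0$, $p_0=\mathbf{0}$ and choose $\|q_1\|=1$. For $j=1,\dots,m$: $s_j=Aq_j-\gamma_{j-1}p_{j-1}$, $\beta_j=\|s_j\|$, stop (breakdown) if $\beta_j=0$, else $p_j=s_j/\beta_j$; $t_j=-Ap_j-\beta_jq_j$, $\gamma_j=\|t_j\|$, stop (breakdown) if $\gamma_j=0$, else $q_{j+1}=t_j/\gamma_j$. Without breakdown, $\{p_i\}_{i=1}^m$ and $\{q_i\}_{i=1}^m$ are orthonormal bases of $\mathcal{U}_m$ and $\mathcal{V}_m$, and these subspaces are mutually orthogonal, so $\mathcal{U}_m\oplus\mathcal{V}_m$ has dimension $2m$. Notation: $\mathcal{K}(M,k,w)=\mathrm{span}\{w,Mw,\dots,M^{k-1}w\}$ is the Krylov subspace; $\mathcal{R}(\cdot)$ is the range; $\|\cdot\|$ is the 2-norm. For subspaces $\mathcal{W},\mathcal{Z}$ with $\dim\mathcal{W}\ge\dim\mathcal{Z}$, $\|\tan\angle(\mathcal{W},\mathcal{Z})\|_F$ is the square root of the sum of squares of the tangents of all the canonical angles between $\mathcal{W}$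 and $\mathcal{Z}$. These tangents are the generalized singular values of the pair $\{W_\perp^HZ,W^HZ\}$, where $W$, $W_\perp$, $Z$ are orthonormal basis matrices of $\mathcal{W}$, its orthogonal complement, and $\mathcal{Z}$; the cosines of the canonical angles are the singular values of $W^HZ$. If the dimensions are equal and $W^HZ$ is nonsingular, then $\|\tan\angle(\mathcal{W},\mathcal{Z})\|_F=\|(I-WW^H)Z(W^HZ)^{-1}\|_F$. *)

theory Defs
  imports "HOL-Analysis.Analysis" "Jordan_Normal_Form.Char_Poly"
begin

(* A direct sum exactly when U and V meet only in 0. *)
definition subspace_sum :: "'a::real_vector set \<Rightarrow> 'a set \<Rightarrow> 'a set" where
  "subspace_sum U V = {x + y |x y. x \<in> U \<and> y \<in> V}"

definition krylov :: "real^'n^'n \<Rightarrow> nat \<Rightarrow> real^'n \<Rightarrow> (real^'n) set" where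
  "krylov M k w = span ((\<lambda>i. (((*v) M) ^^ i) w) ` {..<k})"

definition two_columns :: "real^'n \<Rightarrow> real^'n \<Rightarrow> real^2^'n" where
  "two_columns a b = Finite_Cartesian_Product.transpose (vector [a, b])"

definition mat_range :: "real^'k^'n \<Rightarrow> (real^'n) set" where
  "mat_range M = range ((*v) M)"

definition complex_eigenvalues :: "real^'n^'n \<Rightarrow> complex set" where
  "complex_eigenvalues A =
     {z. \<exists>w. w \<noteq> 0 \<and> map_matrix complex_of_real A *v w = z *s w}"

(* State of the process after j steps: Some (p_j, gamma_j, q_(j+1)), or None once a breakdown
   (beta_i = 0 or gamma_i = 0 for some i <= j) has occurred. *)
primrec sslbd :: "real^'n^'n \<Rightarrow> real^'n \<Rightarrow> nat \<Rightarrow> ((real^'n) \<times> real \<times> (real^'n)) option" where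
  "sslbd A q1 0 = Some (0, 0, q1)"
| "sslbd A q1 (Suc j) =
     (case sslbd A q1 j of
        None \<Rightarrow> None
      | Some (p, \<gamma>, q) \<Rightarrow>
          let s = A *v q - \<gamma> *\<^sub>R p; \<beta> = norm s in
          if \<beta> = 0 then None
          else
            let p' = s /\<^sub>R \<beta>; t = - (A *v p') - \<beta> *\<^sub>R q; \<gamma>' = norm t in
            if \<gamma>' = 0 then None else Some (p', \<gamma>', t /\<^sub>R \<gamma>'))"

definition sslbd_no_breakdown :: "real^'n^'n \<Rightarrow> real^'n \<Rightarrow> nat \<Rightarrow> bool" where
  "sslbd_no_breakdown A q1 m \<longleftrightarrow> sslbd A q1 m \<noteq> None"

definition orthonormal_basis :: "'a::euclidean_space set \<Rightarrow> 'a list \<Rightarrow> bool" where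
  "orthonormal_basis W ws \<longleftrightarrow>
     (\<forall>i<length ws. \<forall>k<length ws. ws ! i \<bullet> ws ! k = (if i = k then 1 else 0)) \<and>
     span (set ws) = W"

(* The product W^H Z of basis matrices whose columns are the vectors of ws and zs. *)
definition cross_gram :: "'a::euclidean_space list \<Rightarrow> 'a list \<Rightarrow> real mat" where
  "cross_gram ws zs = Matrix.mat (length ws) (length zs) (\<lambda>(i, k). ws ! i \<bullet> zs ! k)"

(* Square roots of the eigenvalues of M^T M with algebraic multiplicity: as many values as M has
   columns, hence the usual singular values when M has at least as many rows as columns. *)
definition singular_values :: "real mat \<Rightarrow> real multiset" where
  "singular_values M = image_mset sqrt (proots (char_poly (transpose_mat M * M)))"

(* Meant for subspaces W, Z with dim W >= dim Z; there are then dim Z canonical angles, all in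
   [0, pi/2].  The result does not depend on the orthonormal bases chosen. *)
definition canonical_angles :: "'a::euclidean_space set \<Rightarrow> 'a set \<Rightarrow> real multiset" where
  "canonical_angles W Z =
     image_mset arccos
       (singular_values
          (cross_gram (SOME ws. orthonormal_basis W ws) (SOME zs. orthonormal_basis Z zs)))"

(* Extended real, since the tangent of an angle pi/2 is infinite (whereas tan (pi/2) = 0 in HOL). *)
definition tan_angle_F :: "'a::euclidean_space set \<Rightarrow> 'a set \<Rightarrow> ereal" where
  "tan_angle_F W Z =
     (if pi / 2 \<in># canonical_angles W Z then \<infinity>
      else ereal (sqrt (\<Sum>\<theta>\<in>#canonical_angles W Z. (tan \<theta>)\<^sup>2)))"

fun chebyshev :: "nat \<Rightarrow> real poly" where
  "chebyshev 0 = 1"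
| "chebyshev (Suc 0) = [:0, 1:]"
| "chebyshev (Suc (Suc k)) = [:0, 2:] * chebyshev (Suc k) - chebyshev k"

end

theory Submission
  imports Defs
begin

text \<open>
  If \<open>Z\<close> is a plane with orthonormal basis \<open>z\<^sub>1, z\<^sub>2\<close>, then the square of the Frobenius norm of the
  tangents between \<open>W\<close> and \<open>Z\<close> is the minimum of \<open>\<parallel>h\<^sub>1\<parallel>\<^sup>2 + \<parallel>h\<^sub>2\<parallel>\<^sup>2 - 2\<close> over all
  \<open>h\<^sub>1, h\<^sub>2 \<in> W\<close> with \<open>h\<^sub>i \<bullet> z\<^sub>k = \<delta>\<^sub>i\<^sub>k\<close>; it is infinite if there are no such vectors.
  Take \<open>h\<^sub>1, h\<^sub>2\<close> minimal for the starting plane \<open>\<Y>\<close> and apply to them \<open>F = P(A\<^sup>2)\<close>, where \<open>P\<close> has degree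
  less than \<open>m\<close>. The images lie in the sum of the two Krylov spaces. As \<open>F\<close> is symmetric and,
  when \<open>P(- \<sigma>\<^sub>j\<^sup>2) = 1\<close>, fixes the vectors of \<open>\<X>\<^sub>j\<close>, the images satisfy the same
  constraints, while \<open>F\<close> shrinks the components \<open>h\<^sub>i - z\<^sub>i\<close>, orthogonal to \<open>\<X>\<^sub>j\<close>, by the maximum
  of \<open>\<bar>P\<bar>\<close> on the other eigenvalues of \<open>A\<^sup>2\<close>. A product of linear factors that kills the
  eigenvalues before the \<open>j\<close>-th, times a scaled Chebyshev polynomial, makes this maximum at
  most the stated constant.
\<close>

no_notation Matrix.scalar_prod (infix "\<bullet>" 70)
no_notation Matrix.vec_index (infixl "$" 100)

section \<open>Two by two spectra, and tangents expressed through squared cosines\<close>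

lemma char_poly_two:
  assumes "M \<in> carrier_mat 2 2"
  shows "char_poly M =
    [: M $$ (0,0) * M $$ (1,1) - M $$ (0,1) * M $$ (1,0), - (M $$ (0,0) + M $$ (1,1)), 1 :]"
proof -
  let ?C = "char_poly_matrix M"
  have C: "?C \<in> carrier_mat 2 2" using assms by simp
  have "char_poly M = (\<Sum>i<2. ?C $$ (i,0) * Determinant.cofactor ?C i 0)"
    unfolding char_poly_def by (rule laplace_expansion_column[OF C]) simp
  also have "\<dots> = ?C $$ (0,0) * ?C $$ (1,1) - ?C $$ (1,0) * ?C $$ (0,1)"
    using C by (simp add: numeral_2_eq_2 Determinant.cofactor_def det_single mat_delete_def)
  finally show ?thesis
    using assms by (simp add: char_poly_matrix_def algebra_simps)
qed

lemma proots_quadratic: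
  fixes x y :: "'a::idom"
  shows "proots [: x * y, - (x + y), 1 :] = {# x, y #}"
proof -
  have "[: x * y, - (x + y), 1 :] = [: - x, 1 :] * [: - y, 1 :]" by (simp add: algebra_simps)
  also have "proots \<dots> = proots [: - x, 1 :] + proots [: - y, 1 :]" by (rule proots_mult) simp_all
  finally show ?thesis by (simp only: proots_linear_factor) simp
qed

lemma tan_arccos_sqrt_squared:
  assumes "0 < x" "x \<le> 1"
  shows "(tan (arccos (sqrt x)))\<^sup>2 = 1 / x - 1"
proof -
  have "-1 \<le> sqrt x" "sqrt x \<le> 1" using assms by (auto intro: order_trans[of _ 0])
  then show ?thesis
    using assms by (simp add: tan_def sin_arccos power_divide diff_divide_distrib)
qed

text \<open>With \<open>x\<close> an eigenvalue of the Gram product, the test for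
  \<open>pi / 2\<close> in \<open>tan_angle_F\<close> becomes a test for a zero eigenvalue, hence
  for a zero determinant.\<close>

lemma arccos_sqrt_eq_pi_half_iff:
  assumes "0 \<le> x" "x \<le> 1"
  shows "arccos (sqrt x) = pi / 2 \<longleftrightarrow> x = 0"
proof -
  have "arccos (sqrt x) = arccos 0 \<longleftrightarrow> sqrt x = 0"
    using assms by (intro arccos_eq_iff) auto
  then show ?thesis by simp
qed

section \<open>Orthonormal bases and orthogonal projections\<close>

lemma orthonormal_basis_exists:
  assumes "subspace W"
  shows "\<exists>ws. orthonormal_basis W ws"
proof -
  obtain B where B: "B \<subseteq> W" "pairwise Linear_Algebra.orthogonal B" "\<And>x. x \<in> B \<Longrightarrow> norm x = 1"
      "independent B" "span B = W"
    using orthonormal_basis_subspace[OF assms] by metis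
  obtain ws where ws: "set ws = B" "distinct ws"
    using finite_distinct_list[OF independent_imp_finite[OF B(4)]] by auto
  have "ws ! i \<bullet> ws ! k = (if i = k then 1 else 0)" if "i < length ws" "k < length ws" for i k
  proof (cases "i = k")
    case True
    then show ?thesis using B(3)[of "ws ! k"] that ws by (auto simp: norm_eq_1)
  next
    case False
    then have "ws ! i \<noteq> ws ! k" using ws that by (simp add: nth_eq_iff_index_eq)
    then show ?thesis using B(2) that ws False by (auto simp: pairwise_def Linear_Algebra.orthogonal_def)
  qed
  then show ?thesis using B(5) ws(1) unfolding orthonormal_basis_def by blast
qed

text \<open>The basis picked by \<open>SOME\<close> is an arbitrary list. This fixes its length, so
  that for a plane it can be written as a list of two vectors.\<close>

lemma orthonormal_basis_length:
  assumes "orthonormal_basis W ws"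
  shows "length ws = dim W"
proof -
  have o: "ws ! i \<bullet> ws ! k = (if i = k then 1 else 0)" if "i < length ws" "k < length ws" for i k
    using assms that unfolding orthonormal_basis_def by blast
  have "distinct ws"
    unfolding distinct_conv_nth using o by (metis zero_neq_one)
  moreover have "independent (set ws)"
  proof (rule pairwise_orthogonal_independent)
    show "pairwise Linear_Algebra.orthogonal (set ws)"
      unfolding pairwise_def Linear_Algebra.orthogonal_def using o by (metis in_set_conv_nth)
    show "0 \<notin> set ws"
      using o by (metis in_set_conv_nth inner_zero_left zero_neq_one)
  qed
  ultimately show ?thesis
    using assms unfolding orthonormal_basis_def
    by (metis dim_span_eq_card_independent distinct_card)
qed

definition orth_proj :: "'a::euclidean_space list \<Rightarrow> 'a \<Rightarrow> 'a" where
  "orth_proj ws x = (\<Sum>i<length ws. (ws ! i \<bullet> x) *\<^sub>R ws ! i)"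

text \<open>The residual is orthogonal to each basis vector, hence to \<open>W\<close>. The last
  equation lets the entries of the Gram product of \<open>cross_gram\<close> be read as inner
  products of projections.\<close>

lemma orth_proj:
  assumes "orthonormal_basis W ws"
  shows "orth_proj ws x \<in> W" "w \<in> W \<Longrightarrow> w \<bullet> orth_proj ws x = w \<bullet> x"
    "orth_proj ws x \<bullet> orth_proj ws y = (\<Sum>i<length ws. (ws ! i \<bullet> x) * (ws ! i \<bullet> y))"
proof -
  have o: "ws ! i \<bullet> ws ! k = (if i = k then 1 else 0)" if "i < length ws" "k < length ws" for i k
    using assms that unfolding orthonormal_basis_def by blast
  have W: "W = span (set ws)" using assms unfolding orthonormal_basis_def by blast
  show mem: "orth_proj ws x \<in> W" for x
    unfolding orth_proj_def W by (intro span_sum span_mul span_base) auto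
  have nth: "ws ! k \<bullet> orth_proj ws x = ws ! k \<bullet> x" if "k < length ws" for k x
  proof -
    have "ws ! k \<bullet> orth_proj ws x = (\<Sum>i<length ws. (ws ! i \<bullet> x) * (ws ! k \<bullet> ws ! i))"
      by (simp add: orth_proj_def inner_sum_right)
    also have "\<dots> = (\<Sum>i<length ws. if i = k then ws ! i \<bullet> x else 0)"
      using that by (intro sum.cong) (auto simp: o)
    finally show ?thesis using that by simp
  qed
  show "w \<bullet> orth_proj ws x = w \<bullet> x" if "w \<in> W" for w
  proof -
    have "Linear_Algebra.orthogonal (orth_proj ws x - x) w"
      using that unfolding W
    proof (rule orthogonal_to_span)
      fix y assume "y \<in> set ws"
      then show "Linear_Algebra.orthogonal (orth_proj ws x - x) y"
        using nth unfolding in_set_conv_nth Linear_Algebra.orthogonal_def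
        by (auto simp: inner_diff_right inner_commute[of _ y] inner_commute[of "orth_proj ws x - x"])
    qed
    then show ?thesis
      by (simp add: Linear_Algebra.orthogonal_def inner_commute[of _ w] inner_diff_right)
  qed
  have "orth_proj ws x \<bullet> orth_proj ws y = (\<Sum>i<length ws. (ws ! i \<bullet> x) * (ws ! i \<bullet> orth_proj ws y))"
    unfolding orth_proj_def[of ws x] by (simp add: inner_sum_left)
  then show "orth_proj ws x \<bullet> orth_proj ws y = (\<Sum>i<length ws. (ws ! i \<bullet> x) * (ws ! i \<bullet> y))"
    by (simp add: nth)
qed

section \<open>Tangents of the angles with a plane as a minimum\<close>

text \<open>
  The assumption on \<open>SOME\<close> names the basis that \<^const>\<open>tan_angle_F\<close> itself chooses for \<open>Z\<close>, so
  that independence of this choice is not needed. \<open>D\<close> is the product of the squared cosines, and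
  \<open>g\<^sub>1, g\<^sub>2\<close> are the orthogonal projections of \<open>z\<^sub>1, z\<^sub>2\<close> to \<open>W\<close>.
\<close>

lemma tan_angle_F_two_dim:
  fixes W Z :: "'a::euclidean_space set"
  assumes W: "subspace W" and zs: "(SOME zs. orthonormal_basis Z zs) = [z1, z2]"
    and Z: "orthonormal_basis Z [z1, z2]"
  obtains g1 g2 where "g1 \<in> W" "g2 \<in> W"
    "\<And>w. w \<in> W \<Longrightarrow> w \<bullet> g1 = w \<bullet> z1" "\<And>w. w \<in> W \<Longrightarrow> w \<bullet> g2 = w \<bullet> z2"
    "tan_angle_F W Z =
      (let D = (g1 \<bullet> g1) * (g2 \<bullet> g2) - (g1 \<bullet> g2)\<^sup>2 in
       if D = 0 then \<infinity> else ereal (sqrt ((g1 \<bullet> g1 + g2 \<bullet> g2) / D - 2)))"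
proof -
  define ws where "ws = (SOME ws. orthonormal_basis W ws)"
  have ws: "orthonormal_basis W ws"
    unfolding ws_def by (rule someI_ex) (rule orthonormal_basis_exists[OF W])
  define g where "g = orth_proj ws"
  note proj = orth_proj[OF ws, folded g_def]
  define G where "G = cross_gram ws [z1, z2]"
  define a where "a = g z1 \<bullet> g z1"
  define b where "b = g z1 \<bullet> g z2"
  define d where "d = g z2 \<bullet> g z2"
  have G: "G \<in> carrier_mat (length ws) 2" 
    unfolding G_def cross_gram_def by (rule carrier_matI) simp_all
  have entry: "(transpose_mat G * G) $$ (i, k) = g ([z1, z2] ! i) \<bullet> g ([z1, z2] ! k)"
    if "i < 2" "k < 2" for i k
  proof -
    have "(transpose_mat G * G) $$ (i, k) = (\<Sum>p<length ws. G $$ (p, i) * G $$ (p, k))"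
      using G that by (simp add: scalar_prod_def atLeast0LessThan)
    also have "\<dots> = (\<Sum>p<length ws. (ws ! p \<bullet> [z1, z2] ! i) * (ws ! p \<bullet> [z1, z2] ! k))"
      using that by (intro sum.cong) (simp_all add: G_def cross_gram_def)
    finally show ?thesis by (simp only: proj(3))
  qed
  have charpoly: "char_poly (transpose_mat G * G) = [: a * d - b\<^sup>2, - (a + d), 1 :]"
  proof (subst char_poly_two)
    show "transpose_mat G * G \<in> carrier_mat 2 2" using G by simp
  qed (simp add: entry a_def b_def d_def power2_eq_square inner_commute[of "g z2" "g z1"])
  have zz: "z1 \<bullet> z1 = 1" "z2 \<bullet> z2 = 1" "z1 \<bullet> z2 = 0"
    using Z unfolding orthonormal_basis_def by (auto simp: All_less_Suc numeral_2_eq_2)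
  have nonneg: "0 \<le> a" "0 \<le> d" "0 \<le> a * d - b\<^sup>2"
    using Cauchy_Schwarz_ineq[of "g z1" "g z2"] by (auto simp: a_def b_def d_def)
  have "g x \<bullet> y = g x \<bullet> g y" for x y
    by (rule proj(2)[OF proj(1), symmetric])
  from this[of z1 z1] this[of z1 z2] this[of z2 z1] this[of z2 z2]
  have gz: "g z1 \<bullet> z1 = a" "g z1 \<bullet> z2 = b" "g z2 \<bullet> z1 = b" "g z2 \<bullet> z2 = d"
    unfolding a_def b_def d_def by (simp_all only: inner_commute[of "g z2" "g z1"])
  have resid: "(z1 - g z1) \<bullet> (z1 - g z1) = 1 - a" "(z2 - g z2) \<bullet> (z2 - g z2) = 1 - d"
    "(z1 - g z1) \<bullet> (z2 - g z2) = - b"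
    by (simp_all add: inner_diff_left inner_diff_right zz gz
        inner_commute[of z1 "g z1"] inner_commute[of z1 "g z2"] inner_commute[of z2 "g z2"]
        a_def[symmetric] b_def[symmetric] d_def[symmetric])
  \<comment> \<open>The residuals have Gram matrix \<open>I - M\<close>, where \<open>M\<close> is
    the Gram matrix of the projections. Both are positive semidefinite, which will place the
    eigenvalues of \<open>M\<close> between 0 and 1.\<close>
  have le: "a \<le> 1" "d \<le> 1" "0 \<le> (1 - a) * (1 - d) - b\<^sup>2"
    using inner_ge_zero[of "z1 - g z1"] inner_ge_zero[of "z2 - g z2"]
      Cauchy_Schwarz_ineq[of "z1 - g z1" "z2 - g z2"]
    unfolding resid by auto
  define r where "r = sqrt ((a - d)\<^sup>2 + 4 * b\<^sup>2)"
  define x where "x = (a + d + r) / 2"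
  define y where "y = (a + d - r) / 2"
  have r2: "r\<^sup>2 = (a - d)\<^sup>2 + 4 * b\<^sup>2" "0 \<le> r" by (simp_all add: r_def)
  have sum: "x + y = a + d" by (simp add: x_def y_def field_simps)
  have prod: "x * y = a * d - b\<^sup>2"
    using r2(1) by (simp add: x_def y_def field_simps power2_eq_square)
  \<comment> \<open>The two differences are four times the determinants of \<open>M\<close> and of
    \<open>I - M\<close>. The resulting bounds on \<open>r\<close> say that the smaller root
    \<open>y\<close> is nonnegative and the larger root \<open>x\<close> is at most 1.\<close>
  have "r\<^sup>2 \<le> (a + d)\<^sup>2" "r\<^sup>2 \<le> (2 - a - d)\<^sup>2"
    using nonneg(3) le(3) unfolding r2(1) by (simp_all add: power2_eq_square algebra_simps)
  then have "r \<le> a + d" "r \<le> 2 - a - d"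
    using nonneg le by (auto intro: power2_le_imp_le)
  then have x: "0 \<le> x" "x \<le> 1" and y: "0 \<le> y" "y \<le> 1"
    using r2(2) nonneg le by (auto simp: x_def y_def)
  have "proots (char_poly (transpose_mat G * G)) = {# x, y #}"
    using proots_quadratic[of x y] charpoly unfolding sum prod by simp
  then have ca: "canonical_angles W Z = {# arccos (sqrt x), arccos (sqrt y) #}"
    unfolding canonical_angles_def zs ws_def[symmetric] G_def[symmetric] singular_values_def
    by simp
  have tan: "tan_angle_F W Z = (if a * d - b\<^sup>2 = 0 then \<infinity>
          else ereal (sqrt ((a + d) / (a * d - b\<^sup>2) - 2)))"
  proof (cases "a * d - b\<^sup>2 = 0")
    case True
    then have "x = 0 \<or> y = 0" using prod by simp
    then show ?thesis using True x y by (auto simp: tan_angle_F_def ca)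
  next
    case False
    then have ne: "x \<noteq> 0" "y \<noteq> 0" using prod by auto
    \<comment> \<open>The squared tangents are \<open>1 / x - 1\<close> and
      \<open>1 / y - 1\<close>, so they sum to trace over determinant, minus 2.\<close>
    have "1 / x + 1 / y = (a + d) / (a * d - b\<^sup>2)"
      unfolding prod[symmetric] sum[symmetric] using ne by (simp add: field_simps)
    moreover have "pi / 2 \<notin># canonical_angles W Z"
      using arccos_sqrt_eq_pi_half_iff[of x] arccos_sqrt_eq_pi_half_iff[of y] x y ne
      by (auto simp: ca)
    ultimately show ?thesis
      using False x y ne
      by (simp add: tan_angle_F_def ca tan_arccos_sqrt_squared order_less_le algebra_simps)
  qed
  show thesis
    by (rule that[of "g z1" "g z2"])
      (rule proj(1) | erule proj(2) | simp add: tan Let_def a_def b_def d_def)+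
qed

text \<open>The minimizers are the basis of the projection of \<open>Z\<close> to \<open>W\<close> dual to the projections \<open>g\<^sub>i\<close> of \<open>z\<^sub>i\<close>.\<close>

lemma tan_angle_F_attained:
  fixes W Z :: "'a::euclidean_space set"
  assumes W: "subspace W" and zs: "(SOME zs. orthonormal_basis Z zs) = [z1, z2]"
    and Z: "orthonormal_basis Z [z1, z2]"
    and fin: "tan_angle_F W Z \<noteq> \<infinity>"
  obtains h1 h2 where "h1 \<in> W" "h2 \<in> W"
    "h1 \<bullet> z1 = 1" "h1 \<bullet> z2 = 0" "h2 \<bullet> z1 = 0" "h2 \<bullet> z2 = 1"
    "tan_angle_F W Z = ereal (sqrt (h1 \<bullet> h1 + h2 \<bullet> h2 - 2))"
proof -
  obtain g1 g2 where g: "g1 \<in> W" "g2 \<in> W"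
    "\<And>w. w \<in> W \<Longrightarrow> w \<bullet> g1 = w \<bullet> z1" "\<And>w. w \<in> W \<Longrightarrow> w \<bullet> g2 = w \<bullet> z2"
    "tan_angle_F W Z =
      (let D = (g1 \<bullet> g1) * (g2 \<bullet> g2) - (g1 \<bullet> g2)\<^sup>2 in
       if D = 0 then \<infinity> else ereal (sqrt ((g1 \<bullet> g1 + g2 \<bullet> g2) / D - 2)))"
    using tan_angle_F_two_dim[OF W zs Z] by blast
  define a b d where "a = g1 \<bullet> g1" and "b = g1 \<bullet> g2" and "d = g2 \<bullet> g2"
  define D where "D = a * d - b\<^sup>2"
  have D: "D \<noteq> 0" and tan: "tan_angle_F W Z = ereal (sqrt ((a + d) / D - 2))"
    using g(5) fin by (auto simp: Let_def a_def b_def d_def D_def split: if_splits)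
  \<comment> \<open>The coefficients are the rows of the inverse of the Gram matrix of
    \<open>g1\<close>, \<open>g2\<close>. Hence the squared norms below are its diagonal entries,
    and they add up to trace over determinant.\<close>
  define h1 where "h1 = (d / D) *\<^sub>R g1 - (b / D) *\<^sub>R g2"
  define h2 where "h2 = (a / D) *\<^sub>R g2 - (b / D) *\<^sub>R g1"
  have mem: "h1 \<in> W" "h2 \<in> W"
    unfolding h1_def h2_def using W g(1,2) by (auto intro: subspace_diff subspace_scale)
  have gg: "g1 \<bullet> g1 = a" "g1 \<bullet> g2 = b" "g2 \<bullet> g1 = b" "g2 \<bullet> g2 = d"
    by (auto simp: a_def b_def d_def inner_commute)
  have *: "h1 \<bullet> g1 = 1" "h1 \<bullet> g2 = 0" "h2 \<bullet> g1 = 0" "h2 \<bullet> g2 = 1"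
    using D by (auto simp: h1_def h2_def inner_diff_left gg D_def power2_eq_square
        diff_divide_distrib[symmetric] algebra_simps)
  have "h1 \<bullet> h1 = d / D" "h2 \<bullet> h2 = a / D"
    using * by (simp_all add: h1_def h2_def inner_diff_right)
  then have "tan_angle_F W Z = ereal (sqrt (h1 \<bullet> h1 + h2 \<bullet> h2 - 2))"
    unfolding tan by (simp add: add_divide_distrib add.commute)
  with that[of h1 h2] mem * g(3,4) show thesis by metis
qed

text \<open>Cauchy-Schwarz against the dual basis vectors bounds the norm of each competitor from
  below. The existence of competitors also makes the projections independent, which excludes the
  infinite value.\<close>

lemma tan_angle_F_le:
  fixes W Z :: "'a::euclidean_space set"
  assumes W: "subspace W" and zs: "(SOME zs. orthonormal_basis Z zs) = [z1, z2]"
    and Z: "orthonormal_basis Z [z1, z2]"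
    and s: "s1 \<in> W" "s2 \<in> W" "s1 \<bullet> z1 = 1" "s1 \<bullet> z2 = 0" "s2 \<bullet> z1 = 0" "s2 \<bullet> z2 = 1"
  shows "tan_angle_F W Z \<le> ereal (sqrt (s1 \<bullet> s1 + s2 \<bullet> s2 - 2))"
proof -
  obtain g1 g2 where g: "g1 \<in> W" "g2 \<in> W"
    "\<And>w. w \<in> W \<Longrightarrow> w \<bullet> g1 = w \<bullet> z1" "\<And>w. w \<in> W \<Longrightarrow> w \<bullet> g2 = w \<bullet> z2"
    "tan_angle_F W Z =
      (let D = (g1 \<bullet> g1) * (g2 \<bullet> g2) - (g1 \<bullet> g2)\<^sup>2 in
       if D = 0 then \<infinity> else ereal (sqrt ((g1 \<bullet> g1 + g2 \<bullet> g2) / D - 2)))"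
    using tan_angle_F_two_dim[OF W zs Z] by blast
  define a b d where "a = g1 \<bullet> g1" and "b = g1 \<bullet> g2" and "d = g2 \<bullet> g2"
  define D where "D = a * d - b\<^sup>2"
  have gg: "g1 \<bullet> g1 = a" "g1 \<bullet> g2 = b" "g2 \<bullet> g1 = b" "g2 \<bullet> g2 = d"
    by (auto simp: a_def b_def d_def inner_commute)
  have sg: "s1 \<bullet> g1 = 1" "s1 \<bullet> g2 = 0" "s2 \<bullet> g1 = 0" "s2 \<bullet> g2 = 1"
    using g(3,4) s by auto
  have D0: "0 \<le> D"
    using Cauchy_Schwarz_ineq[of g1 g2] by (simp add: D_def gg)
  \<comment> \<open>These are the dual basis vectors multiplied by \<open>D\<close>. Avoiding the
    division allows Cauchy-Schwarz to be applied before \<open>D\<close> is known to be nonzero; its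
    outcome then yields \<open>D > 0\<close>.\<close>
  define k1 where "k1 = d *\<^sub>R g1 - b *\<^sub>R g2"
  define k2 where "k2 = a *\<^sub>R g2 - b *\<^sub>R g1"
  have k: "s1 \<bullet> k1 = d" "s2 \<bullet> k2 = a" "k1 \<bullet> k1 = d * D" "k2 \<bullet> k2 = a * D"
    by (simp_all add: k1_def k2_def inner_diff_left inner_diff_right sg gg D_def
        power2_eq_square algebra_simps)
  have "0 < a" "0 < d" using sg by (auto simp: a_def d_def)
  moreover have "d * d \<le> (s1 \<bullet> s1) * (d * D)" "a * a \<le> (s2 \<bullet> s2) * (a * D)"
    using Cauchy_Schwarz_ineq[of s1 k1] Cauchy_Schwarz_ineq[of s2 k2]
    by (simp_all add: k power2_eq_square)
  ultimately have le: "d \<le> (s1 \<bullet> s1) * D" "a \<le> (s2 \<bullet> s2) * D"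
    by (simp_all add: mult.left_commute)
  then have "D \<noteq> 0" using \<open>0 < a\<close> by auto
  with D0 have "0 < D" by simp
  then have "d / D \<le> s1 \<bullet> s1" "a / D \<le> s2 \<bullet> s2"
    using le by (simp_all add: pos_divide_le_eq)
  moreover have "tan_angle_F W Z = ereal (sqrt ((a + d) / D - 2))"
    using g(5) \<open>D \<noteq> 0\<close> by (simp add: Let_def gg D_def)
  ultimately show ?thesis by (simp add: add_divide_distrib)
qed

section \<open>Chebyshev polynomials inside and beyond the unit interval\<close>

lemma chebyshev_cos: "poly (chebyshev k) (cos t) = cos (real k * t)"
proof (induction k rule: chebyshev.induct)
  case (3 k)
  have e: "real (Suc (Suc k)) * t = real (Suc k) * t + t" "real k * t = real (Suc k) * t - t"
    by (simp_all add: algebra_simps)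
  show ?case
    unfolding chebyshev.simps poly_diff poly_mult 3 e cos_add cos_diff by simp
qed auto

lemma abs_chebyshev_le_1:
  assumes "\<bar>x\<bar> \<le> 1"
  shows "\<bar>poly (chebyshev k) x\<bar> \<le> 1"
  using chebyshev_cos[of k "arccos x"] assms by (simp add: cos_arccos_abs)

lemma chebyshev_ge_1:
  assumes "1 \<le> x"
  shows "1 \<le> poly (chebyshev k) x"
proof -
  \<comment> \<open>The recurrence subtracts an earlier value, so the lower bound is carried
    together with monotonicity in the degree: for \<open>x \<ge> 1\<close> the increments do not
    decrease.\<close>
  have "1 \<le> poly (chebyshev k) x \<and> poly (chebyshev k) x \<le> poly (chebyshev (Suc k)) x"
  proof (induction k)
    case (Suc k)
    let ?T = "\<lambda>i. poly (chebyshev i) x"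
    have "?T (Suc k) \<le> x * ?T (Suc k)" using Suc assms mult_right_mono[of 1 x "?T (Suc k)"] by simp
    moreover have "?T (Suc (Suc k)) = 2 * (x * ?T (Suc k)) - ?T k" by (simp add: algebra_simps)
    ultimately show ?case using Suc by linarith
  qed (use assms in simp)
  then show ?thesis ..
qed

lemma degree_chebyshev_le: "degree (chebyshev k) \<le> k"
proof (induction k rule: chebyshev.induct)
  case (3 k)
  have "degree ([:0, 2:] * chebyshev (Suc k)) \<le> Suc (Suc k)"
    using degree_mult_le[of "[:0, 2:]" "chebyshev (Suc k)"] 3 by simp
  then show ?case using 3 by (auto intro: degree_diff_le)
qed auto

section \<open>Polynomials in a matrix and Krylov spaces\<close>

definition poly_apply :: "real poly \<Rightarrow> real^'n^'n \<Rightarrow> real^'n \<Rightarrow> real^'n" where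
  "poly_apply P M x = (\<Sum>i\<le>degree P. coeff P i *\<^sub>R (((*v) M) ^^ i) x)"

lemma matrix_funpow_linear: "linear (((*v) (M :: real^'n^'n)) ^^ i)"
proof (induction i)
  case 0
  show ?case by (rule linearI) simp_all
next
  case (Suc i)
  show ?case
    unfolding funpow.simps(2) by (rule linear_compose[OF Suc matrix_vector_mul_linear])
qed

lemma poly_apply_linear: "linear (poly_apply P M)"
proof -
  note [simp] = linear_add[OF matrix_funpow_linear] linear_scale[OF matrix_funpow_linear]
  show ?thesis
    by (rule linearI)
      (simp_all add: poly_apply_def scaleR_add_right sum.distrib scaleR_sum_right algebra_simps)
qed

lemma poly_apply_eigenvector:
  assumes "M *v x = t *\<^sub>R x"
  shows "poly_apply P M x = poly P t *\<^sub>R x"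
proof -
  have "(((*v) M) ^^ i) x = t ^ i *\<^sub>R x" for i
    by (induction i) (simp_all add: assms matrix_vector_mult_scaleR mult.commute)
  then show ?thesis by (simp add: poly_apply_def poly_altdef scaleR_sum_left)
qed

lemma poly_apply_self_adjoint:
  assumes "\<And>x y. (M *v x) \<bullet> y = x \<bullet> (M *v y)"
  shows "poly_apply P M x \<bullet> y = x \<bullet> poly_apply P M y"
proof -
  have "(((*v) M) ^^ i) x \<bullet> y = x \<bullet> (((*v) M) ^^ i) y" for i
  proof (induction i arbitrary: y)
    case (Suc i)
    have "(((*v) M) ^^ Suc i) x \<bullet> y = (((*v) M) ^^ i) x \<bullet> (M *v y)" by (simp add: assms)
    also have "\<dots> = x \<bullet> (((*v) M) ^^ Suc i) y" by (simp add: Suc funpow_swap1)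
    finally show ?case .
  qed simp
  then show ?thesis by (simp add: poly_apply_def inner_sum_left inner_sum_right)
qed

text \<open>\<open>poly_apply\<close> is written with iterates of the matrix action, so its summands
  are multiples of the generators in \<open>krylov\<close>.\<close>

lemma poly_apply_mem_krylov:
  assumes "degree P < k"
  shows "poly_apply P M x \<in> krylov M k x"
  unfolding poly_apply_def krylov_def
  using assms by (intro span_sum span_mul span_base) auto

lemma subspace_krylov: "subspace (krylov M k w)"
  by (simp add: krylov_def)

section \<open>Sums of subspaces, planes and orthonormal families\<close>

lemma subspace_subspace_sum:
  assumes "subspace U" "subspace V"
  shows "subspace (subspace_sum U V)"
  using subspace_sums[OF assms] unfolding subspace_sum_def .

lemma span_pair: "span {a, b} = {c *\<^sub>R a + d *\<^sub>R b |c d. True}"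
  unfolding span_insert span_empty by (auto simp: algebra_simps eq_diff_eq)

lemma mat_range_two_columns: "mat_range (two_columns a b) = span {a, b}"
proof -
  have "two_columns a b *v x = (x $ 1) *\<^sub>R a + (x $ 2) *\<^sub>R b" for x :: "real^2"
    by (simp add: two_columns_def matrix_vector_mult_def Finite_Cartesian_Product.transpose_def
        Finite_Cartesian_Product.vec_eq_iff sum_2 mult.commute[of _ "x $ _"])
  then have "mat_range (two_columns a b) = range (\<lambda>x :: real^2. (x $ 1) *\<^sub>R a + (x $ 2) *\<^sub>R b)"
    by (simp add: mat_range_def)
  also have "\<dots> = {c *\<^sub>R a + d *\<^sub>R b |c d. True}"
  proof safe
    fix c d :: real
    show "c *\<^sub>R a + d *\<^sub>R b \<in> range (\<lambda>x :: real^2. (x $ 1) *\<^sub>R a + (x $ 2) *\<^sub>R b)"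
      by (rule range_eqI[of _ _ "vector [c, d]"]) simp
  qed blast
  finally show ?thesis by (simp only: span_pair)
qed

text \<open>The difference between \<open>x\<close> and its expansion is orthogonal to a spanning
  family, hence to itself. Indexing by a family lets the \<open>u i\<close> and \<open>v i\<close>
  be joined over a disjoint sum of index sets.\<close>

lemma orthonormal_family_parseval:
  fixes e :: "'i \<Rightarrow> 'a::euclidean_space"
  assumes "finite I" "span (e ` I) = UNIV"
    and "\<And>i k. i \<in> I \<Longrightarrow> k \<in> I \<Longrightarrow> e i \<bullet> e k = (if i = k then 1 else 0)"
  shows "x \<bullet> x = (\<Sum>i\<in>I. (x \<bullet> e i)\<^sup>2)"
proof -
  define y where "y = (\<Sum>i\<in>I. (x \<bullet> e i) *\<^sub>R e i)"
  have "Linear_Algebra.orthogonal (x - y) (e k)" if "k \<in> I" for k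
  proof -
    have "y \<bullet> e k = (\<Sum>i\<in>I. if i = k then x \<bullet> e i else 0)"
      unfolding y_def inner_sum_left using that by (intro sum.cong) (auto simp: assms(3))
    then show ?thesis using that assms(1) by (simp add: Linear_Algebra.orthogonal_def inner_diff_left)
  qed
  then have "Linear_Algebra.orthogonal (x - y) (x - y)"
    using orthogonal_to_span[of "x - y" "e ` I" "x - y"] assms(2) by blast
  then have "x = y" by (simp add: orthogonal_self)
  then have "x \<bullet> x = x \<bullet> y" by simp
  then show ?thesis by (simp add: y_def inner_sum_right power2_eq_square)
qed

section \<open>The filter polynomial\<close>

lemma filter_polynomial_exists:
  fixes s :: "nat \<Rightarrow> real"
  assumes j: "1 \<le> j" "j < m" "m < l"
    and dec: "\<And>i k. 1 \<le> i \<Longrightarrow> i < k \<Longrightarrow> k \<le> l \<Longrightarrow> s k < s i"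
  defines "\<xi> \<equiv> 1 + 2 * ((s j - s (j + 1)) / (s (j + 1) - s l))"
    and "\<eta> \<equiv> \<Prod>i=1..j - 1. (s i - s l) / (s i - s j)"
  obtains P where "degree P < m" "poly P (- s j) = 1"
    "\<And>i. 1 \<le> i \<Longrightarrow> i \<le> l \<Longrightarrow> i \<noteq> j \<Longrightarrow> \<bar>poly P (- s i)\<bar> \<le> \<eta> / poly (chebyshev (m - j)) \<xi>"
    "0 < \<eta> / poly (chebyshev (m - j)) \<xi>"
proof -
  define D where "D = s (j + 1) - s l"
  define T where "T = chebyshev (m - j)"
  \<comment> \<open>In the application \<open>s i\<close> is the square of
    \<open>\<sigma> i\<close>, so the eigenvalues of the squared matrix are \<open>- s i\<close>.
    \<open>R\<close> vanishes at those with \<open>i < j\<close> and is 1 at \<open>- s j\<close>.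
    \<open>L\<close> maps the interval from \<open>- s (j + 1)\<close> to \<open>- s l\<close>
    affinely onto that from 1 to -1, and sends \<open>- s j\<close> to \<open>\<xi>\<close>.\<close>
  define R where "R = (\<Prod>i=1..j - 1. [: s i / (s i - s j), 1 / (s i - s j) :])"
  define L where "L = [: 1 - 2 * s (j + 1) / D, - 2 / D :]"
  define P where "P = Polynomial.smult (1 / poly T \<xi>) (R * pcompose T L)"
  have D: "0 < D" unfolding D_def using dec[of "j + 1" l] j by simp
  have "1 \<le> \<xi>"
    unfolding \<xi>_def D_def[symmetric] using D dec[of j "j + 1"] j by simp
  then have T\<xi>: "1 \<le> poly T \<xi>" unfolding T_def by (rule chebyshev_ge_1)
  have gap: "0 < s i - s j" if "i \<in> {1..j - 1}" for i using dec[of i j] that j by auto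
  have polyR: "poly R (- t) = (\<Prod>i=1..j - 1. (s i - t) / (s i - s j))" for t
    unfolding R_def poly_prod by (simp add: diff_divide_distrib)
  have polyL: "poly L (- t) = 1 + 2 * ((t - s (j + 1)) / D)" for t
    using D by (simp add: L_def field_simps)
  have polyP: "poly P (- t) = poly R (- t) * poly T (poly L (- t)) / poly T \<xi>" for t
    by (simp add: P_def poly_pcompose)
  \<comment> \<open>The degrees \<open>j - 1\<close> and \<open>m - j\<close> add up to
    \<open>m - 1\<close>, the largest that a Krylov space of order \<open>m\<close> admits.\<close>
  have "degree R \<le> (\<Sum>i=1..j - 1. 1)"
    unfolding R_def
    by (rule order_trans[OF degree_prod_sum_le], simp, rule sum_mono, unfold o_def,
        rule order_trans[OF degree_pCons_le]) simp
  moreover have "degree (pcompose T L) \<le> m - j"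
    using degree_pcompose_le[of T L] degree_chebyshev_le[of "m - j"]
      mult_le_mono[of "degree T" "m - j" "degree L" 1]
    by (simp add: T_def L_def)
  ultimately have "degree P < m"
    using degree_mult_le[of R "pcompose T L"] j
      degree_smult_le[of "1 / poly T \<xi>" "R * pcompose T L"] unfolding P_def by auto
  moreover have "poly P (- s j) = 1"
  proof -
    have "poly R (- s j) = 1" unfolding polyR using gap by (intro prod.neutral) force
    moreover have "poly L (- s j) = \<xi>" by (simp add: polyL \<xi>_def D_def)
    ultimately show ?thesis using T\<xi> by (simp add: polyP)
  qed
  moreover have eta: "0 < \<eta> / poly T \<xi>"
  proof -
    have "0 < (s i - s l) / (s i - s j)" if "i \<in> {1..j - 1}" for i
      using gap[OF that] dec[of i l] that j by auto
    then have "0 < \<eta>" unfolding \<eta>_def by (rule prod_pos)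
    then show ?thesis using T\<xi> by simp
  qed
  moreover have "\<bar>poly P (- s i)\<bar> \<le> \<eta> / poly T \<xi>" if i: "1 \<le> i" "i \<le> l" "i \<noteq> j" for i
  proof (cases "i < j")
    case True
    then have "poly R (- s i) = 0"
      unfolding polyR using i by (intro prod_zero) auto
    then show ?thesis using eta by (simp add: polyP)
  next
    case False
    then have "j < i" using i by simp
    moreover have "s l \<le> s i" using i dec[of i l] by (cases "i = l") auto
    moreover have "s i \<le> s (j + 1)" using \<open>j < i\<close> i dec[of "j + 1" i] by (cases "i = j + 1") auto
    ultimately have si: "s l \<le> s i" "s i \<le> s (j + 1)" "s i < s j"
      using dec[of j i] i j by auto
    have "\<bar>poly L (- s i)\<bar> \<le> 1"
      unfolding polyL using si D by (simp add: abs_le_iff field_simps D_def)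
    then have "\<bar>poly T (poly L (- s i))\<bar> \<le> 1" unfolding T_def by (rule abs_chebyshev_le_1)
    \<comment> \<open>Each factor decreases in \<open>s i\<close>, so its worst case is at the
      smallest value \<open>s l\<close>; this is where \<open>\<eta>\<close> comes from.\<close>
    moreover have "\<bar>poly R (- s i)\<bar> \<le> \<eta>"
      unfolding polyR \<eta>_def abs_prod
    proof (rule prod_mono, safe)
      fix k assume k: "k \<in> {1..j - 1}"
      show "\<bar>(s k - s i) / (s k - s j)\<bar> \<le> (s k - s l) / (s k - s j)"
        using gap[OF k] si by (simp add: abs_divide divide_right_mono)
    qed simp
    ultimately have "\<bar>poly R (- s i)\<bar> * \<bar>poly T (poly L (- s i))\<bar> \<le> \<eta> * 1"
      by (intro mult_mono) auto
    then show ?thesis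
      using T\<xi> by (simp add: polyP abs_mult abs_divide divide_right_mono)
  qed
  ultimately show thesis using that unfolding T_def by blast
qed

section \<open>Filtering the starting plane\<close>

theorem theorem4p1:
  fixes A :: "real^'n^'n"
    and u v :: "nat \<Rightarrow> real^'n"
    and \<sigma> :: "nat \<Rightarrow> real"
    and q1 p1 :: "real^'n"
    and X Y :: "real^2^'n"
    and U V :: "(real^'n) set"
    and \<xi> \<eta> :: real
    and l m j :: nat
  assumes dim: "CARD('n) = 2 * l"
    and nonsingular: "invertible A"
    and skew: "Finite_Cartesian_Product.transpose A = - A"
    and \<sigma>_pos: "\<forall>i\<in>{1..l}. 0 < \<sigma> i"
    and \<sigma>_decreasing: "\<forall>i\<in>{1..l}. \<forall>k\<in>{1..l}. i < k \<longrightarrow> \<sigma> k < \<sigma> i"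
    \<comment> \<open>these are \<open>2 * l\<close> distinct values, so all eigenvalues are simple\<close>
    and eigenvalues:
      "complex_eigenvalues A = (\<Union>i\<in>{1..l}. {\<i> * of_real (\<sigma> i), - \<i> * of_real (\<sigma> i)})"
    and u_orthonormal: "\<forall>i\<in>{1..l}. \<forall>k\<in>{1..l}. u i \<bullet> u k = (if i = k then 1 else 0)"
    and v_orthonormal: "\<forall>i\<in>{1..l}. \<forall>k\<in>{1..l}. v i \<bullet> v k = (if i = k then 1 else 0)"
    and uv_orthogonal: "\<forall>i\<in>{1..l}. \<forall>k\<in>{1..l}. u i \<bullet> v k = 0"
    and uv_basis: "span (u ` {1..l} \<union> v ` {1..l}) = UNIV"
    and A_v: "\<forall>i\<in>{1..l}. A *v v i = \<sigma> i *\<^sub>R u i"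
    and A_u: "\<forall>i\<in>{1..l}. A *v u i = - (\<sigma> i *\<^sub>R v i)"
    and m: "m < l"
    and q1_unit: "norm q1 = 1"
    and no_breakdown: "sslbd_no_breakdown A q1 m"
    and p1: "p1 = (A *v q1) /\<^sub>R norm (A *v q1)"
    and U: "U = krylov (A ** A) m p1"
    and V: "V = krylov (A ** A) m q1"
    and Y: "Y = two_columns p1 q1"
    and j: "1 \<le> j" "j < m"
    and X: "X = two_columns (u j) (v j)"
    and XY_nonsingular: "invertible (Finite_Cartesian_Product.transpose X ** Y)"
    and \<xi>: "\<xi> = 1 + 2 * (((\<sigma> j)\<^sup>2 - (\<sigma> (j + 1))\<^sup>2) / ((\<sigma> (j + 1))\<^sup>2 - (\<sigma> l)\<^sup>2))"
    and \<eta>: "\<eta> = (if j = 1 then 1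
               else \<Prod>i=1..j - 1. ((\<sigma> i)\<^sup>2 - (\<sigma> l)\<^sup>2) / ((\<sigma> i)\<^sup>2 - (\<sigma> j)\<^sup>2))"
  shows "tan_angle_F (subspace_sum U V) (mat_range X)
           \<le> ereal (\<eta> / poly (chebyshev (m - j)) \<xi>) * tan_angle_F (mat_range Y) (mat_range X)"
proof -
  let ?I = "{1..l}"
  define s where "s = (\<lambda>i. (\<sigma> i)\<^sup>2)"
  define c where "c = \<eta> / poly (chebyshev (m - j)) \<xi>"
  have jl: "j \<in> ?I" using j m by simp
  have dec: "s k < s i" if "1 \<le> i" "i < k" "k \<le> l" for i k
    unfolding s_def using \<sigma>_decreasing \<sigma>_pos that
    by (intro power_strict_mono) (auto intro: less_imp_le)
  \<comment> \<open>For \<open>j = 1\<close> the product is empty, so the two cases of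
    \<open>\<eta>\<close> merge.\<close>
  have \<eta>': "\<eta> = (\<Prod>i=1..j - 1. (s i - s l) / (s i - s j))"
    using \<eta> by (simp add: s_def)
  have c: "c = (\<Prod>i=1..j - 1. (s i - s l) / (s i - s j)) /
      poly (chebyshev (m - j)) (1 + 2 * ((s j - s (j + 1)) / (s (j + 1) - s l)))"
    unfolding c_def \<eta>' \<xi> s_def by (rule refl)
  have "\<exists>P. degree P < m \<and> poly P (- s j) = 1 \<and>
      (\<forall>i. 1 \<le> i \<longrightarrow> i \<le> l \<longrightarrow> i \<noteq> j \<longrightarrow> \<bar>poly P (- s i)\<bar> \<le> c) \<and> 0 < c"
    unfolding c
  proof (rule filter_polynomial_exists[OF j m, of s])
    show "s k < s i" if "1 \<le> i" "i < k" "k \<le> l" for i k using that by (rule dec)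
  qed blast
  then obtain P where P: "degree P < m" "poly P (- s j) = 1"
    "\<And>i. 1 \<le> i \<Longrightarrow> i \<le> l \<Longrightarrow> i \<noteq> j \<Longrightarrow> \<bar>poly P (- s i)\<bar> \<le> c" "0 < c"
    by blast
  define F where "F = poly_apply P (A ** A)"
  have neg: "(- A) *v x = - (A *v x)" for x
    by (simp add: matrix_vector_mult_def Finite_Cartesian_Product.vec_eq_iff sum_negf)
  \<comment> \<open>Moving \<open>A\<close> across the inner product costs a sign; moving its square
    costs two, so \<open>F\<close> is self-adjoint.\<close>
  have "(A *v x) \<bullet> y = - (x \<bullet> (A *v y))" for x y
    using dot_lmul_matrix[of x A y] neg[of x]
    unfolding transpose_matrix_vector[symmetric] skew by simp
  then have sym: "F x \<bullet> y = x \<bullet> F y" for x y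
    unfolding F_def
    by (intro poly_apply_self_adjoint) (simp add: matrix_vector_mul_assoc[symmetric])
  have eig: "F (u i) = poly P (- s i) *\<^sub>R u i" "F (v i) = poly P (- s i) *\<^sub>R v i" if "i \<in> ?I" for i
    unfolding F_def using that A_u A_v
    by (auto intro!: poly_apply_eigenvector
        simp: matrix_vector_mul_assoc[symmetric] matrix_vector_mult_scaleR
          linear_neg[OF matrix_vector_mul_linear] s_def power2_eq_square)
  have Fmem: "F x \<in> subspace_sum U V" if mem: "x \<in> span {p1, q1}" for x
  proof -
    obtain a b where x: "x = a *\<^sub>R p1 + b *\<^sub>R q1"
      using mem unfolding span_pair by blast
    have "F p1 \<in> U" "F q1 \<in> V" unfolding F_def U V using P(1) by (rule poly_apply_mem_krylov)+
    then have "a *\<^sub>R F p1 \<in> U" "b *\<^sub>R F q1 \<in> V"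
      unfolding U V using subspace_krylov by (auto intro: subspace_scale)
    moreover have "F x = a *\<^sub>R F p1 + b *\<^sub>R F q1"
      unfolding x F_def by (simp add: linear_add linear_scale poly_apply_linear)
    ultimately show ?thesis unfolding subspace_sum_def by blast
  qed
  have uv: "u i \<bullet> u k = (if i = k then 1 else 0)" "v i \<bullet> v k = (if i = k then 1 else 0)"
    "u i \<bullet> v k = 0" if "i \<in> ?I" "k \<in> ?I" for i k
    using that u_orthonormal v_orthonormal uv_orthogonal by blast+
  define Z where "Z = mat_range X"
  have Z: "Z = span {u j, v j}" by (simp add: Z_def X mat_range_two_columns)
  have ZY: "mat_range Y = span {p1, q1}" by (simp add: Y mat_range_two_columns)
  have uvj: "orthonormal_basis Z [u j, v j]"
    using jl by (auto simp: uv orthonormal_basis_def Z less_Suc_eq inner_commute[of "v _" "u _"])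
  \<comment> \<open>This is the basis of \<open>Z\<close> that \<open>tan_angle_F\<close> selects,
    possibly different from \<open>u j\<close>, \<open>v j\<close>. The latter pair shows that a
    basis exists and has two elements.\<close>
  define zs where "zs = (SOME zs. orthonormal_basis Z zs)"
  have zs: "orthonormal_basis Z zs" unfolding zs_def using uvj by (rule someI)
  have "length zs = 2"
    using orthonormal_basis_length[OF zs] orthonormal_basis_length[OF uvj] by simp
  then obtain z1 z2 where z12: "zs = [z1, z2]"
    by (metis (no_types, opaque_lifting) One_nat_def Suc_length_conv length_0_conv numeral_2_eq_2)
  note zz = zs[unfolded z12] zs_def[unfolded z12, symmetric]
  have zI: "z1 \<bullet> z1 = 1" "z2 \<bullet> z2 = 1" "z1 \<bullet> z2 = 0"
    and Zspan: "Z = span {z1, z2}"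
    using zz(1) unfolding orthonormal_basis_def by (auto simp: All_less_Suc numeral_2_eq_2)
  have FZ: "F z = z" if mem: "z \<in> Z" for z
  proof -
    obtain a b where z: "z = a *\<^sub>R u j + b *\<^sub>R v j"
      using mem unfolding Z span_pair by blast
    show ?thesis
      using eig[OF jl] P(2) unfolding z F_def
      by (simp add: linear_add linear_scale poly_apply_linear)
  qed
  have zmem: "z1 \<in> Z" "z2 \<in> Z" unfolding Zspan by (auto intro: span_base)
  have parseval: "x \<bullet> x = (\<Sum>i\<in>?I. (x \<bullet> u i)\<^sup>2 + (x \<bullet> v i)\<^sup>2)" for x
  proof -
    have "x \<bullet> x = (\<Sum>i\<in>?I <+> ?I. (x \<bullet> case_sum u v i)\<^sup>2)"
    proof (rule orthonormal_family_parseval)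
      have "case_sum u v ` (?I <+> ?I) = u ` ?I \<union> v ` ?I" 
        by (simp add: Plus_def image_Un image_image)
      then show "span (case_sum u v ` (?I <+> ?I)) = UNIV" using uv_basis by simp
      show "case_sum u v i \<bullet> case_sum u v k = (if i = k then 1 else 0)"
        if "i \<in> ?I <+> ?I" "k \<in> ?I <+> ?I" for i k
        using that by (auto simp: uv inner_commute[of "v _" "u _"] split: if_splits)
    qed simp
    then show ?thesis by (simp add: sum.Plus sum.distrib)
  qed
  \<comment> \<open>\<open>F\<close> is diagonal in the basis of singular vectors. Since
    \<open>r\<close> is orthogonal to \<open>Z\<close>, its components along \<open>u j\<close> and
    \<open>v j\<close>, where the factor is 1, vanish; all others are scaled by at most
    \<open>c\<close>.\<close>
  have contract: "F r \<bullet> F r \<le> c\<^sup>2 * (r \<bullet> r)" if rz: "r \<bullet> z1 = 0" "r \<bullet> z2 = 0" for r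
  proof -
    have "Linear_Algebra.orthogonal r z" if "z \<in> Z" for z
      using that(1) unfolding Zspan
      by (rule orthogonal_to_span) (use rz in \<open>auto simp: Linear_Algebra.orthogonal_def\<close>)
    then have rj: "r \<bullet> u j = 0" "r \<bullet> v j = 0"
      unfolding Z Linear_Algebra.orthogonal_def by (auto intro: span_base)
    have "(F r \<bullet> u i)\<^sup>2 + (F r \<bullet> v i)\<^sup>2 \<le> c\<^sup>2 * ((r \<bullet> u i)\<^sup>2 + (r \<bullet> v i)\<^sup>2)" if i: "i \<in> ?I" for i
    proof (cases "i = j")
      case True
      then show ?thesis using rj by (simp add: sym eig[OF jl])
    next
      case False
      have "(poly P (- s i))\<^sup>2 \<le> c\<^sup>2"
        using P(3)[of i] i False P(4) by (intro iffD1[OF abs_le_square_iff]) auto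
      then show ?thesis
        by (auto simp: sym eig[OF i] power_mult_distrib distrib_left[symmetric]
            intro!: mult_right_mono)
    qed
    then show ?thesis
      unfolding parseval[of "F r"] parseval[of r] sum_distrib_left by (rule sum_mono)
  qed
  \<comment> \<open>Here \<open>w\<close> stands for \<open>z1\<close> or \<open>z2\<close>, and
    \<open>h\<close> for the matching minimizer. As \<open>F\<close> fixes \<open>w\<close> and
    \<open>h - w\<close> is orthogonal to \<open>Z\<close>, Pythagoras identifies
    \<open>h \<bullet> h - 1\<close> and \<open>F h \<bullet> F h - 1\<close> with the squared norms
    of \<open>h - w\<close> and its image.\<close>
  have bound: "F h \<bullet> z = h \<bullet> z" "F h \<bullet> F h - 1 \<le> c\<^sup>2 * (h \<bullet> h - 1)"
    if "z \<in> Z" "w \<in> Z" "w \<bullet> w = 1" "h \<bullet> w = 1" "(h - w) \<bullet> z1 = 0" "(h - w) \<bullet> z2 = 0" for h z w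
  proof -
    show "F h \<bullet> z = h \<bullet> z" by (simp add: sym FZ that(1))
    have Fh: "F h \<bullet> w = 1" by (simp add: sym FZ that)
    have "F (h - w) = F h - w"
      unfolding F_def using FZ[OF that(2)] by (simp add: F_def linear_diff poly_apply_linear)
    then have "F (h - w) \<bullet> F (h - w) = F h \<bullet> F h - 1" "(h - w) \<bullet> (h - w) = h \<bullet> h - 1"
      using Fh that(3,4)
      by (simp_all add: inner_diff_left inner_diff_right inner_commute[of w h] inner_commute[of w "F h"])
    then show "F h \<bullet> F h - 1 \<le> c\<^sup>2 * (h \<bullet> h - 1)" using contract[of "h - w"] that by simp
  qed
  have UV: "subspace (subspace_sum U V)"
    unfolding U V by (intro subspace_subspace_sum subspace_krylov)
  have "tan_angle_F (subspace_sum U V) Z \<le> ereal c * tan_angle_F (mat_range Y) Z"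
  proof (cases "tan_angle_F (mat_range Y) Z = \<infinity>")
    \<comment> \<open>Since \<open>c > 0\<close>, the right-hand side is infinite too.\<close>
    case True
    then show ?thesis using P(4) by simp
  next
    case False
    then obtain h1 h2 where h: "h1 \<in> mat_range Y" "h2 \<in> mat_range Y"
      "h1 \<bullet> z1 = 1" "h1 \<bullet> z2 = 0" "h2 \<bullet> z1 = 0" "h2 \<bullet> z2 = 1"
      and tan: "tan_angle_F (mat_range Y) Z = ereal (sqrt (h1 \<bullet> h1 + h2 \<bullet> h2 - 2))"
      using tan_angle_F_attained[OF _ zz(2,1), of "mat_range Y"] unfolding ZY by auto
    have b1: "F h1 \<bullet> z = h1 \<bullet> z" "F h1 \<bullet> F h1 - 1 \<le> c\<^sup>2 * (h1 \<bullet> h1 - 1)" if "z \<in> Z" for z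
      using bound[of z z1 h1] that zmem zI h by (simp_all add: inner_diff_left)
    have b2: "F h2 \<bullet> z = h2 \<bullet> z" "F h2 \<bullet> F h2 - 1 \<le> c\<^sup>2 * (h2 \<bullet> h2 - 1)" if "z \<in> Z" for z
      using bound[of z z2 h2] that zmem zI h by (simp_all add: inner_diff_left inner_commute[of z2 z1])
    \<comment> \<open>The images \<open>F h1\<close>, \<open>F h2\<close> have the same inner
      products with \<open>z1\<close>, \<open>z2\<close> as the minimizers, so they are competitors
      in the sum of the Krylov spaces.\<close>
    have "tan_angle_F (subspace_sum U V) Z \<le> ereal (sqrt (F h1 \<bullet> F h1 + F h2 \<bullet> F h2 - 2))"
      using h Fmem zmem by (intro tan_angle_F_le[OF UV zz(2,1)]) (auto simp: ZY b1 b2)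
    also have "F h1 \<bullet> F h1 + F h2 \<bullet> F h2 - 2 \<le> c\<^sup>2 * (h1 \<bullet> h1 + h2 \<bullet> h2 - 2)"
      using b1(2)[OF zmem(1)] b2(2)[OF zmem(1)] by (simp add: algebra_simps)
    then have "sqrt (F h1 \<bullet> F h1 + F h2 \<bullet> F h2 - 2) \<le> c * sqrt (h1 \<bullet> h1 + h2 \<bullet> h2 - 2)"
      using P(4) real_sqrt_le_mono by (fastforce simp: real_sqrt_mult)
    finally show ?thesis unfolding tan by simp
  qed
  then show ?thesis by (simp add: Z_def c_def)
qed

end
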